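(* For the extended reflection algebra $\mathcal{XB}(\mathcal G)$, the relation $\mathsf c(u)=1$ is equivalent to the symmetry relation $$\mathsf X^t(u)=(\pm)\,\mathsf X(\kappa-u)\pm\frac{\mathsf X(u)-\mathsf X(\kappa-u)}{2u-\kappa}+\frac{\mathrm{tr}(\mathcal G(u))\,\mathsf X(\kappa-u)-\mathrm{tr}(\mathsf X(u))\cdot I}{2u-2\kappa},$$ that is, in any quotient algebra of $\mathcal{XB}(\mathcal G)$ one of these relations holds if and only if the other does.
   Context: Notation. Tensor products are over $\mathbb C$. $\mathfrak g$ is $\mathfrak{so}_N$ ($N=2n$ or $N=2n+1$) or $\mathfrak{sp}_N$ ($N=2n$), $n\ge1$. Rows and columns of $N\times N$ matrices are indexed by $-n,\dots,-1,1,\dots,n$ if $N=2n$ and by $-n,\dots,n$ (including $0$) if $N=2n+1$. $\theta_{ij}=1$ in the orthogonal case and $\theta_{ij}=\mathrm{sign}(i)\,\mathrm{sign}(j)$ in the symplectic case. The transposition $t$ is $(E_{ij})^t=\theta_{ij}E_{-j,-i}$. In $\pm,\mp$ the upper sign is for the orthogonal case, the lower for the symplectic case; the sign $(\pm)$ is $-$ in types CI and DIII and $+$ in the other types. $\kappa=N/2\mp1$. $P=\sum_{i,j}E_{ij}\otimes E_{ji}$, $Q=\sum_{i,j}\theta_{ij}E_{ij}\otimes E_{-i,-j}$, $R(u)=I-\frac{P}{u}+\frac{Q}{u-\kappa}$. Subscripts 1, 2 on matrices indicate the copy of $\mathrm{End}\,\mathbb C^N$; rational functions are expanded in $u^{-1}$.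 The matrix $\mathcal G=(g_{ij})$ is one of the following. BCD0: $\mathcal G=I$. CI ($\mathfrak g=\mathfrak{sp}_N$) and DIII ($\mathfrak g=\mathfrak{so}_N$, $N$ even): $\mathcal G=\sum_{i=1}^{N/2}(E_{ii}-E_{-i,-i})$. CII ($\mathfrak g=\mathfrak{sp}_N$, $N=p+q$, $p,q$ even, $p\ge q>0$): $\mathcal G=-\sum_{i=1}^{q/2}(E_{ii}+E_{-i,-i})+\sum_{i=q/2+1}^{N/2}(E_{ii}+E_{-i,-i})$. BDI ($\mathfrak g=\mathfrak{so}_N$, $N=p+q$, with $p>q>0$ if $N$ is odd, $p\ge q>0$ if $N$ is even): $\mathcal G=\sum_{i=1}^{(p-q)/2}(E_{ii}+E_{-i,-i})+\sum_{i=(p-q)/2+1}^{N/2}(E_{-i,i}+E_{i,-i})$ for $N$ even, and $\mathcal G=\sum_{i=-(p-q-1)/2}^{(p-q-1)/2}E_{ii}+\sum_{i=(p-q+1)/2}^{(N-1)/2}(E_{-i,i}+E_{i,-i})$ for $N$ odd. Set $\mathcal G(u)=\mathcal G$ in types BCD0, CI, DIII and in types BDI, CII with $p=q$; set $\mathcal G(u)=(I-cu\,\mathcal G)(1-cu)^{-1}$, $c=\frac{4}{p-q}$, in types BDI, CII with $p>q$. Extended reflection algebra. $\mathcal{XB}(\mathcal G)$ is the unital associative $\mathbb C$-algebra generated by $\mathsf x_{ij}^{(r)}$, $r\ge0$, $\mathsf x_{ij}^{(0)}=g_{ij}$, such that $\mathsf X(u)=\sum_{i,j}\sum_{r\ge0}E_{ij}\otimes\mathsf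 x_{ij}^{(r)}u^{-r}$ satisfies only the reflection equation $$R(u-v)\,\mathsf X_1(u)\,R(u+v)\,\mathsf X_2(v)=\mathsf X_2(v)\,R(u+v)\,\mathsf X_1(u)\,R(u-v).$$ Set $p(u)=(\pm)1\mp\frac1{2u-\kappa}+\frac{\mathrm{tr}(\mathcal G(u))}{2u-2\kappa}$. The series $\mathsf c(u)\in1+u^{-1}\mathcal{XB}(\mathcal G)[[u^{-1}]]$ is defined by $$Q\,\mathsf X_1(u)\,R(2u-\kappa)\,\mathsf X_2^{-1}(\kappa-u)=\mathsf X_2^{-1}(\kappa-u)\,R(2u-\kappa)\,\mathsf X_1(u)\,Q=p(u)\,\mathsf c(u)\,Q .$$ *)

theory Defs
  imports
    Complex_Main
    "HOL-Library.Poly_Mapping"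
    "HOL-Computational_Algebra.Formal_Laurent_Series"
    "HOL-Algebra.QuotRing"
begin

unbundle fps_syntax

section \<open>Types of symmetric pairs and index sets\<close>

text \<open>\<open>BCD0 b N\<close> is the trivial pair for \<open>so_N\<close> (if \<open>b\<close> holds) or \<open>sp_N\<close> (otherwise);
  the arguments of \<open>CI\<close> and \<open>DIII\<close> are \<open>N\<close>, those of \<open>CII\<close> and \<open>BDI\<close> are \<open>p\<close> and \<open>q\<close>.\<close>

datatype pair_type = BCD0 bool nat | CI nat | DIII nat | CII nat nat | BDI nat nat

fun orthogonal :: "pair_type \<Rightarrow> bool" where
  "orthogonal (BCD0 b N) = b"
| "orthogonal (CI N) = False"
| "orthogonal (DIII N) = True"
| "orthogonal (CII p q) = False"
| "orthogonal (BDI p q) = True"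

fun dimN :: "pair_type \<Rightarrow> nat" where
  "dimN (BCD0 b N) = N"
| "dimN (CI N) = N"
| "dimN (DIII N) = N"
| "dimN (CII p q) = p + q"
| "dimN (BDI p q) = p + q"

fun valid_pair :: "pair_type \<Rightarrow> bool" where
  "valid_pair (BCD0 b N) \<longleftrightarrow> N \<ge> 2 \<and> (\<not> b \<longrightarrow> even N)"
| "valid_pair (CI N) \<longleftrightarrow> N \<ge> 2 \<and> even N"
| "valid_pair (DIII N) \<longleftrightarrow> N \<ge> 2 \<and> even N"
| "valid_pair (CII p q) \<longleftrightarrow> even p \<and> even q \<and> p \<ge> q \<and> q > 0"
| "valid_pair (BDI p q) \<longleftrightarrow> q > 0 \<and> (if odd (p + q) then p > q else p \<ge> q)"

definition idx :: "pair_type \<Rightarrow> int set" where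
  "idx T = (let n = int (dimN T div 2) in if even (dimN T) then {-n..n} - {0} else {-n..n})"

text \<open>\<open>pm\<close> is the sign \<open>\<plusminus>\<close> (upper sign in the orthogonal case; \<open>\<minusplus>\<close> is its negative),
  \<open>bpm\<close> is the sign \<open>(\<plusminus>)\<close>.\<close>

definition pm :: "pair_type \<Rightarrow> 'k::ring_1" where
  "pm T = (if orthogonal T then 1 else -1)"

definition bpm :: "pair_type \<Rightarrow> 'k::ring_1" where
  "bpm T = (case T of CI N \<Rightarrow> -1 | DIII N \<Rightarrow> -1 | _ \<Rightarrow> 1)"

definition theta :: "pair_type \<Rightarrow> int \<Rightarrow> int \<Rightarrow> 'k::ring_1" where
  "theta T i j = (if orthogonal T then 1 else of_int (sgn i * sgn j))"

definition kappa :: "pair_type \<Rightarrow> 'k::field_char_0" where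
  "kappa T = of_nat (dimN T) / 2 - pm T"

section \<open>Matrices\<close>

text \<open>Matrices are functions of the row and the column index. An element of
  \<open>End \<complex>\<^sup>N \<otimes> End \<complex>\<^sup>N\<close> (with coefficients) is a matrix whose indices are pairs.\<close>

definition munit :: "int \<Rightarrow> int \<Rightarrow> int \<Rightarrow> int \<Rightarrow> 'k::ring_1" where
  "munit i j a b = (if a = i \<and> b = j then 1 else 0)"

definition mone :: "'i \<Rightarrow> 'i \<Rightarrow> 'k::ring_1" where
  "mone a b = (if a = b then 1 else 0)"

definition mmul :: "'i set \<Rightarrow> ('i \<Rightarrow> 'i \<Rightarrow> 'k::ring_1) \<Rightarrow> ('i \<Rightarrow> 'i \<Rightarrow> 'k) \<Rightarrow> 'i \<Rightarrow> 'i \<Rightarrow> 'k" where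
  "mmul S A B a b = (\<Sum>r\<in>S. A a r * B r b)"

definition mtrace :: "'i set \<Rightarrow> ('i \<Rightarrow> 'i \<Rightarrow> 'k::ring_1) \<Rightarrow> 'k" where
  "mtrace S A = (\<Sum>a\<in>S. A a a)"

definition tens :: "(int \<Rightarrow> int \<Rightarrow> 'k::ring_1) \<Rightarrow> (int \<Rightarrow> int \<Rightarrow> 'k)
    \<Rightarrow> int \<times> int \<Rightarrow> int \<times> int \<Rightarrow> 'k" where
  "tens A B r s = A (fst r) (fst s) * B (snd r) (snd s)"

text \<open>The coefficient of \<open>E\<^sub>a\<^sub>b\<close> in \<open>\<Sum>\<^sub>i\<^sub>j A\<^sub>i\<^sub>j \<theta>\<^sub>i\<^sub>j E\<^sub>-\<^sub>j\<^sub>,\<^sub>-\<^sub>i\<close> comes from \<open>i = -b\<close>, \<open>j = -a\<close>.\<close>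

definition mtransp :: "pair_type \<Rightarrow> (int \<Rightarrow> int \<Rightarrow> 'k::ring_1) \<Rightarrow> int \<Rightarrow> int \<Rightarrow> 'k" where
  "mtransp T A a b = theta T (-b) (-a) * A (-b) (-a)"

definition Pmat :: "pair_type \<Rightarrow> int \<times> int \<Rightarrow> int \<times> int \<Rightarrow> 'k::ring_1" where
  "Pmat T r s = (\<Sum>i\<in>idx T. \<Sum>j\<in>idx T. tens (munit i j) (munit j i) r s)"

definition Qmat :: "pair_type \<Rightarrow> int \<times> int \<Rightarrow> int \<times> int \<Rightarrow> 'k::ring_1" where
  "Qmat T r s = (\<Sum>i\<in>idx T. \<Sum>j\<in>idx T. theta T i j * tens (munit i j) (munit (-i) (-j)) r s)"

text \<open>The argument \<open>w\<close> is an element of a field of Laurent series such as \<open>\<complex>((u\<inverse>))\<close>,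
  so that division is expansion in \<open>u\<inverse>\<close>.\<close>

definition Rmat :: "pair_type \<Rightarrow> 'k::field_char_0 \<Rightarrow> int \<times> int \<Rightarrow> int \<times> int \<Rightarrow> 'k" where
  "Rmat T w r s = mone r s - Pmat T r s / w + Qmat T r s / (w - kappa T)"

fun gmat :: "pair_type \<Rightarrow> int \<Rightarrow> int \<Rightarrow> 'k::ring_1" where
  "gmat (BCD0 b N) a b' = mone a b'"
| "gmat (CI N) a b = (\<Sum>i = 1..int N div 2. munit i i a b - munit (-i) (-i) a b)"
| "gmat (DIII N) a b = (\<Sum>i = 1..int N div 2. munit i i a b - munit (-i) (-i) a b)"
| "gmat (CII p q) a b =
     - (\<Sum>i = 1..int q div 2. munit i i a b + munit (-i) (-i) a b)
     + (\<Sum>i = int q div 2 + 1..int (p + q) div 2. munit i i a b + munit (-i) (-i) a b)"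
| "gmat (BDI p q) a b =
     (if even (p + q) then
        (\<Sum>i = 1..(int p - int q) div 2. munit i i a b + munit (-i) (-i) a b)
        + (\<Sum>i = (int p - int q) div 2 + 1..int (p + q) div 2.
             munit (-i) i a b + munit i (-i) a b)
      else
        (\<Sum>i = - ((int p - int q - 1) div 2)..(int p - int q - 1) div 2. munit i i a b)
        + (\<Sum>i = (int p - int q + 1) div 2..(int (p + q) - 1) div 2.
             munit (-i) i a b + munit i (-i) a b))"

text \<open>\<open>gser T u\<close> is the matrix \<open>\<G>(u)\<close>.\<close>

definition gser_pq :: "pair_type \<Rightarrow> nat \<Rightarrow> nat \<Rightarrow> 'k::field_char_0 \<Rightarrow> int \<Rightarrow> int \<Rightarrow> 'k" where
  "gser_pq T p q u a b =
     (if p > q then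
        (let c = 4 / (of_nat p - of_nat q) in (mone a b - c * u * gmat T a b) / (1 - c * u))
      else gmat T a b)"

fun gser :: "pair_type \<Rightarrow> 'k::field_char_0 \<Rightarrow> int \<Rightarrow> int \<Rightarrow> 'k" where
  "gser (CII p q) u = gser_pq (CII p q) p q u"
| "gser (BDI p q) u = gser_pq (BDI p q) p q u"
| "gser (BCD0 b N) u = gmat (BCD0 b N)"
| "gser (CI N) u = gmat (CI N)"
| "gser (DIII N) u = gmat (DIII N)"

definition pfun :: "pair_type \<Rightarrow> 'k::field_char_0 \<Rightarrow> 'k" where
  "pfun T u = bpm T - pm T / (2 * u - kappa T) + mtrace (idx T) (gser T u) / (2 * u - 2 * kappa T)"

section \<open>The free algebra\<close>

text \<open>The letter \<open>(i, j, r)\<close> stands for the generator \<open>x\<^sub>i\<^sub>j\<^sup>(\<^sup>r\<^sup>)\<close>. Words form a monoid under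
  concatenation, written additively so that finitely supported functions on words
  carry the ring structure of the free algebra.\<close>

datatype gword = Word (letters: "(int \<times> int \<times> nat) list")

instantiation gword :: monoid_add
begin
definition "0 = Word []"
definition "v + w = Word (letters v @ letters w)" for v w :: gword
instance by standard (auto simp: zero_gword_def plus_gword_def)
end

type_synonym galg = "gword \<Rightarrow>\<^sub>0 complex"

definition sc :: "complex \<Rightarrow> galg" where
  "sc z = Poly_Mapping.single 0 z"

text \<open>The letters with \<open>r = 0\<close> are not used: \<open>x\<^sub>i\<^sub>j\<^sup>(\<^sup>0\<^sup>)\<close> is the scalar \<open>g\<^sub>i\<^sub>j\<close>.\<close>

definition gens :: "pair_type \<Rightarrow> (int \<times> int \<times> nat) set" where
  "gens T = {(i, j, r). i \<in> idx T \<and> j \<in> idx T \<and> r \<ge> 1}"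

definition xgen :: "pair_type \<Rightarrow> int \<Rightarrow> int \<Rightarrow> nat \<Rightarrow> galg" where
  "xgen T i j r = (if r = 0 then gmat T i j else Poly_Mapping.single (Word [(i, j, r)]) 1)"

definition free_alg :: "pair_type \<Rightarrow> galg ring" where
  "free_alg T = \<lparr>carrier = {f. \<forall>w\<in>Poly_Mapping.keys f. set (letters w) \<subseteq> gens T},
     mult = (*), one = 1, zero = 0, add = (+)\<rparr>"

lemma free_alg_simps:
  "f \<oplus>\<^bsub>free_alg T\<^esub> g = f + g" "f \<otimes>\<^bsub>free_alg T\<^esub> g = f * g"
  "\<zero>\<^bsub>free_alg T\<^esub> = 0" "\<one>\<^bsub>free_alg T\<^esub> = 1"
  by (simp_all add: free_alg_def)

lemma free_alg_mult_closed:
  assumes "f \<in> carrier (free_alg T)" "g \<in> carrier (free_alg T)"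
  shows "f * g \<in> carrier (free_alg T)"
proof -
  have "set (letters w) \<subseteq> gens T" if w: "w \<in> Poly_Mapping.keys (f * g)" for w
  proof -
    obtain a b where "w = a + b" "a \<in> Poly_Mapping.keys f" "b \<in> Poly_Mapping.keys g"
      using w keys_mult[of f g] by blast
    thus ?thesis using assms by (auto simp: free_alg_def plus_gword_def)
  qed
  thus ?thesis by (simp add: free_alg_def)
qed

lemma free_alg_closed:
  "0 \<in> carrier (free_alg T)" "1 \<in> carrier (free_alg T)"
  "f \<in> carrier (free_alg T) \<Longrightarrow> - f \<in> carrier (free_alg T)"
  "f \<in> carrier (free_alg T) \<Longrightarrow> g \<in> carrier (free_alg T) \<Longrightarrow> f + g \<in> carrier (free_alg T)"
  "f \<in> carrier (free_alg T) \<Longrightarrow> g \<in> carrier (free_alg T) \<Longrightarrow> f - g \<in> carrier (free_alg T)"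
  "sc z \<in> carrier (free_alg T)"
proof -
  assume "f \<in> carrier (free_alg T)" "g \<in> carrier (free_alg T)"
  thus "f + g \<in> carrier (free_alg T)" "f - g \<in> carrier (free_alg T)"
    using Poly_Mapping.keys_add[of f g] keys_diff[of f g] unfolding free_alg_def by auto
qed (simp_all add: free_alg_def sc_def zero_gword_def)

lemma ring_free_alg: "ring (free_alg T)"
proof (rule ringI)
  show "abelian_group (free_alg T)"
  proof (rule abelian_groupI)
    fix x assume "x \<in> carrier (free_alg T)"
    thus "\<exists>y\<in>carrier (free_alg T). y \<oplus>\<^bsub>free_alg T\<^esub> x = \<zero>\<^bsub>free_alg T\<^esub>"
      using free_alg_closed(3)[of x T] by (intro bexI[of _ "-x"]) (simp_all add: free_alg_simps)
  qed (simp_all add: free_alg_simps free_alg_closed add.assoc add.commute)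
  show "Group.monoid (free_alg T)"
    by (rule Group.monoidI)
      (simp_all add: free_alg_simps free_alg_closed free_alg_mult_closed mult.assoc)
qed (simp_all add: free_alg_simps distrib_left distrib_right)

section \<open>The extended reflection algebra\<close>

text \<open>Series in \<open>u\<inverse>\<close> with coefficients in \<open>A\<close> are elements of \<open>A fls\<close>, where \<open>fls_X\<close> is \<open>u\<inverse>\<close>
  and hence \<open>fls_X_inv\<close> is \<open>u\<close>. For the two variables of the reflection equation we use
  \<open>A((v\<inverse>))((u\<inverse>))\<close>, that is \<open>A fls fls\<close>, in which rational functions such as \<open>1/(u - v)\<close> are
  expanded in \<open>u\<inverse>\<close>, with coefficients that are Laurent series in \<open>v\<inverse>\<close>.\<close>

definition map_fls :: "('a::zero \<Rightarrow> 'b::zero) \<Rightarrow> 'a fls \<Rightarrow> 'b fls" where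
  "map_fls h f = Abs_fls (\<lambda>k. h (f $$ k))"

definition emb :: "complex fls \<Rightarrow> galg fls" where
  "emb = map_fls sc"

definition emb2 :: "complex fls fls \<Rightarrow> galg fls fls" where
  "emb2 = map_fls emb"

definition Xser :: "pair_type \<Rightarrow> int \<Rightarrow> int \<Rightarrow> galg fps" where
  "Xser T i j = Abs_fps (xgen T i j)"

definition Xu :: "pair_type \<Rightarrow> int \<Rightarrow> int \<Rightarrow> galg fls fls" where
  "Xu T i j = fps_to_fls (Abs_fps (\<lambda>r. fls_const (xgen T i j r)))"

definition Xv :: "pair_type \<Rightarrow> int \<Rightarrow> int \<Rightarrow> galg fls fls" where
  "Xv T i j = fls_const (fps_to_fls (Xser T i j))"

abbreviation var_u :: "complex fls fls" where "var_u \<equiv> fls_X_inv"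
abbreviation var_v :: "complex fls fls" where "var_v \<equiv> fls_const fls_X_inv"

definition idx2 :: "pair_type \<Rightarrow> (int \<times> int) set" where
  "idx2 T = idx T \<times> idx T"

definition refl_lhs :: "pair_type \<Rightarrow> int \<times> int \<Rightarrow> int \<times> int \<Rightarrow> galg fls fls" where
  "refl_lhs T =
     mmul (idx2 T) (\<lambda>r s. emb2 (Rmat T (var_u - var_v) r s))
    (mmul (idx2 T) (tens (Xu T) mone)
    (mmul (idx2 T) (\<lambda>r s. emb2 (Rmat T (var_u + var_v) r s))
                   (tens mone (Xv T))))"

definition refl_rhs :: "pair_type \<Rightarrow> int \<times> int \<Rightarrow> int \<times> int \<Rightarrow> galg fls fls" where
  "refl_rhs T =
     mmul (idx2 T) (tens mone (Xv T))
    (mmul (idx2 T) (\<lambda>r s. emb2 (Rmat T (var_u + var_v) r s))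
    (mmul (idx2 T) (tens (Xu T) mone)
                   (\<lambda>r s. emb2 (Rmat T (var_u - var_v) r s))))"

definition refl_relations :: "pair_type \<Rightarrow> galg set" where
  "refl_relations T =
     {(refl_lhs T r s - refl_rhs T r s) $$ k $$ l | r s k l. r \<in> idx2 T \<and> s \<in> idx2 T}"

definition xb_ideal :: "pair_type \<Rightarrow> galg set" where
  "xb_ideal T = genideal (free_alg T) (refl_relations T)"

text \<open>The relations lie in the free algebra, so \<open>xb_ideal T\<close> is indeed the two-sided ideal they
  generate.\<close>

lemma free_alg_closed_sum:
  "(\<And>a. a \<in> A \<Longrightarrow> f a \<in> carrier (free_alg T)) \<Longrightarrow> (\<Sum>a\<in>A. f a) \<in> carrier (free_alg T)"
  by (induction A rule: infinite_finite_induct) (auto simp: free_alg_closed)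

lemma xgen_in_carrier:
  assumes "i \<in> idx T" "j \<in> idx T"
  shows "xgen T i j r \<in> carrier (free_alg T)"
proof (cases "r = 0")
  case True
  have *: "munit a b c d \<in> carrier (free_alg T)" "mone c d \<in> carrier (free_alg T)"
    for a b c d :: int and T
    by (auto simp: munit_def mone_def free_alg_closed)
  have "gmat T i j \<in> carrier (free_alg T)"
    by (cases T) (auto intro!: free_alg_closed free_alg_closed_sum *)
  with True show ?thesis by (simp add: xgen_def)
next
  case False
  with assms show ?thesis by (auto simp: xgen_def free_alg_def gens_def)
qed

lemma map_fls_nth [simp]:
  assumes "h 0 = 0"
  shows "map_fls h f $$ k = h (f $$ k)"
proof -
  have "\<forall>n<fls_subdegree f. h (f $$ n) = 0"
    using assms by simp
  thus ?thesis
    unfolding map_fls_def by (intro nth_Abs_fls_ex_lower_bound) blast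
qed

lemma fls_sum_nth: "(\<Sum>a\<in>A. f a :: 'a::comm_monoid_add fls) $$ k = (\<Sum>a\<in>A. f a $$ k)"
  by (induction A rule: infinite_finite_induct) auto

lemma sc_0 [simp]: "sc 0 = 0"
  by (simp add: sc_def)

lemma emb_nth [simp]: "emb f $$ k = sc (f $$ k)"
  by (simp add: emb_def)

lemma emb_0 [simp]: "emb 0 = 0"
  by (rule fls_eqI) simp

lemma emb2_nth [simp]: "emb2 f $$ k = emb (f $$ k)"
  by (simp add: emb2_def)

lemma fls_times_carrier:
  assumes "\<And>k. f $$ k \<in> carrier (free_alg T)" "\<And>k. g $$ k \<in> carrier (free_alg T)"
  shows "(f * g) $$ k \<in> carrier (free_alg T)"
  unfolding fls_times_nth(2) by (intro free_alg_closed_sum free_alg_mult_closed assms)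

lemma fls2_times_carrier:
  assumes "\<And>k l. f $$ k $$ l \<in> carrier (free_alg T)" "\<And>k l. g $$ k $$ l \<in> carrier (free_alg T)"
  shows "(f * g) $$ k $$ l \<in> carrier (free_alg T)"
  unfolding fls_times_nth(2) fls_sum_nth
  by (intro free_alg_closed_sum free_alg_mult_closed assms)

lemma mmul2_carrier:
  assumes "\<And>r s k l. r \<in> idx2 T \<Longrightarrow> s \<in> idx2 T \<Longrightarrow> A r s $$ k $$ l \<in> carrier (free_alg T)"
    and "\<And>r s k l. r \<in> idx2 T \<Longrightarrow> s \<in> idx2 T \<Longrightarrow> B r s $$ k $$ l \<in> carrier (free_alg T)"
    and "r \<in> idx2 T" "s \<in> idx2 T"
  shows "mmul (idx2 T) A B r s $$ k $$ l \<in> carrier (free_alg T)"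
  unfolding mmul_def fls_sum_nth
  by (intro free_alg_closed_sum fls2_times_carrier assms)

lemma refl_relations_subset: "refl_relations T \<subseteq> carrier (free_alg T)"
proof -
  have one: "(mone a b :: galg fls fls) $$ k $$ l \<in> carrier (free_alg T)" for a b :: int and k l
    by (auto simp: mone_def free_alg_closed)
  have Xu: "Xu T i j $$ k $$ l \<in> carrier (free_alg T)" if "i \<in> idx T" "j \<in> idx T" for i j k l
    using that by (auto simp: Xu_def xgen_in_carrier free_alg_closed)
  have Xv: "Xv T i j $$ k $$ l \<in> carrier (free_alg T)" if "i \<in> idx T" "j \<in> idx T" for i j k l
    using that by (auto simp: Xv_def Xser_def xgen_in_carrier free_alg_closed)
  have R: "emb2 x $$ k $$ l \<in> carrier (free_alg T)" for x k l
    by (simp add: free_alg_closed)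
  have X1: "tens (Xu T) mone r s $$ k $$ l \<in> carrier (free_alg T)"
    and X2: "tens mone (Xv T) r s $$ k $$ l \<in> carrier (free_alg T)"
    if "r \<in> idx2 T" "s \<in> idx2 T" for r s k l
    using that unfolding tens_def idx2_def
    by (auto intro!: fls2_times_carrier one Xu Xv)
  have "refl_lhs T r s $$ k $$ l \<in> carrier (free_alg T)"
    and "refl_rhs T r s $$ k $$ l \<in> carrier (free_alg T)"
    if "r \<in> idx2 T" "s \<in> idx2 T" for r s k l
    unfolding refl_lhs_def refl_rhs_def by (intro mmul2_carrier R X1 X2 that; assumption)+
  thus ?thesis by (auto simp: refl_relations_def intro!: free_alg_closed)
qed

lemma ideal_xb_ideal: "ideal (xb_ideal T) (free_alg T)"
  unfolding xb_ideal_def by (intro ring.genideal_ideal ring_free_alg refl_relations_subset)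

definition XB :: "pair_type \<Rightarrow> galg set ring" where
  "XB T = free_alg T Quot xb_ideal T"

lemma ring_XB: "ring (XB T)"
  unfolding XB_def by (intro ideal.quotient_is_ring ideal_xb_ideal)

definition xb_proj :: "pair_type \<Rightarrow> galg \<Rightarrow> galg set" where
  "xb_proj T a = xb_ideal T +>\<^bsub>free_alg T\<^esub> a"

section \<open>The series \<open>c(u)\<close> and the symmetry relation\<close>

text \<open>Identities between matrices of series over \<open>XB T\<close> or one of its quotients are formed over
  the free algebra and compared after applying the projection \<open>\<pi>\<close> to all coefficients; as \<open>\<pi>\<close> is
  a homomorphism of algebras, it commutes with all operations involved.\<close>

definition meq_via :: "(galg \<Rightarrow> 'b) \<Rightarrow> 'i set \<Rightarrow> ('i \<Rightarrow> 'i \<Rightarrow> galg fls) \<Rightarrow> ('i \<Rightarrow> 'i \<Rightarrow> galg fls) \<Rightarrow> bool" where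
  "meq_via \<pi> S A B \<longleftrightarrow> (\<forall>a\<in>S. \<forall>b\<in>S. \<forall>k. \<pi> (A a b $$ k) = \<pi> (B a b $$ k))"

text \<open>For \<open>f = \<Sum>\<^sub>r f\<^sub>r u\<^sup>-\<^sup>r\<close> the series \<open>f(\<kappa> - u)\<close> is \<open>\<Sum>\<^sub>r f\<^sub>r (1/(\<kappa> - u))\<^sup>r\<close>, expanded in \<open>u\<inverse>\<close>.\<close>

definition at_u :: "galg fps \<Rightarrow> galg fls" where
  "at_u f = fps_to_fls f"

definition at_kappa_minus_u :: "pair_type \<Rightarrow> galg fps \<Rightarrow> galg fls" where
  "at_kappa_minus_u T f = fps_to_fls (f oo fls_regpart (emb (1 / (kappa T - fls_X_inv))))"

text \<open>\<open>is_c_series T c\<close>: the series \<open>\<Sum>\<^sub>k c\<^sub>k u\<^sup>-\<^sup>k\<close> with coefficients in \<open>XB T\<close> has constant term \<open>1\<close>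
  and satisfies the defining equations of \<open>c(u)\<close>. Here \<open>d\<close> is a lift of this series to the free
  algebra and \<open>Y\<close> a lift of the inverse matrix \<open>X\<inverse>(u)\<close>.\<close>

definition is_c_series :: "pair_type \<Rightarrow> (nat \<Rightarrow> galg set) \<Rightarrow> bool" where
  "is_c_series T c \<longleftrightarrow> c 0 = \<one>\<^bsub>XB T\<^esub> \<and>
     (\<exists>d Y. (\<forall>k. d $ k \<in> carrier (free_alg T) \<and> c k = xb_proj T (d $ k)) \<and>
        (\<forall>i\<in>idx T. \<forall>j\<in>idx T. \<forall>k. Y i j $ k \<in> carrier (free_alg T)) \<and>
        (let X = \<lambda>i j. at_u (Xser T i j);
             Y_u = \<lambda>i j. at_u (Y i j);
             Y_ku = \<lambda>i j. at_kappa_minus_u T (Y i j);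
             Q = Qmat T;
             R = \<lambda>r s. emb (Rmat T (2 * fls_X_inv - kappa T) r s);
             pcQ = \<lambda>r s. emb (pfun T fls_X_inv) * at_u d * Q r s;
             mul = mmul (idx2 T)
         in meq_via (xb_proj T) (idx T) (mmul (idx T) X Y_u) mone \<and>
            meq_via (xb_proj T) (idx T) (mmul (idx T) Y_u X) mone \<and>
            meq_via (xb_proj T) (idx2 T)
              (mul Q (mul (tens X mone) (mul R (tens mone Y_ku)))) pcQ \<and>
            meq_via (xb_proj T) (idx2 T)
              (mul (tens mone Y_ku) (mul R (mul (tens X mone) Q))) pcQ))"

text \<open>The relations \<open>c(u) = 1\<close> and the symmetry relation, read in the quotient \<open>XB T Quot J\<close>.\<close>

definition c_trivial_mod :: "pair_type \<Rightarrow> galg set set \<Rightarrow> (nat \<Rightarrow> galg set) \<Rightarrow> bool" where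
  "c_trivial_mod T J c \<longleftrightarrow>
     (\<forall>k. J +>\<^bsub>XB T\<^esub> c k = (if k = 0 then \<one>\<^bsub>XB T Quot J\<^esub> else \<zero>\<^bsub>XB T Quot J\<^esub>))"

definition symmetry_mod :: "pair_type \<Rightarrow> galg set set \<Rightarrow> bool" where
  "symmetry_mod T J \<longleftrightarrow>
     (let u = fls_X_inv;
          X = \<lambda>i j. at_u (Xser T i j);
          X_ku = \<lambda>i j. at_kappa_minus_u T (Xser T i j)
      in meq_via (\<lambda>a. J +>\<^bsub>XB T\<^esub> xb_proj T a) (idx T)
           (mtransp T X)
           (\<lambda>i j. bpm T * X_ku i j
              + pm T * emb (1 / (2 * u - kappa T)) * (X i j - X_ku i j)
              + emb (1 / (2 * u - 2 * kappa T)) *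
                  (emb (mtrace (idx T) (gser T u)) * X_ku i j - mtrace (idx T) X * mone i j)))"

end

theory Submission
  imports Defs
begin

text \<open>
  Write \<open>w = 2 u - \<kappa>\<close>, so that \<open>R(w) = I - P / w + Q / (2 u - 2 \<kappa>)\<close>. The whole theorem is a computation
  of the single matrix product that defines \<open>c(u)\<close>. Three properties of the rank one operator \<open>Q\<close>
  are used: \<open>Q A\<^sub>1 = Q (A\<^sup>t)\<^sub>2\<close>, \<open>Q A\<^sub>1 P = \<plusminus> Q A\<^sub>2\<close> and \<open>Q A\<^sub>1 Q = tr(A) Q\<close>. They give
  \<open>Q X\<^sub>1(u) R(w) = Q M(u)\<^sub>2\<close> with the contracted matrix
  \<open>M(u) = X\<^sup>t(u) \<minusplus> X(u) / w + tr(X(u)) / (2 u - 2 \<kappa>)\<close>,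
  and since \<open>Q A\<^sub>2\<close> determines \<open>A\<close>, the first defining equation of \<open>c(u)\<close> says
  \<open>M(u) X\<inverse>(\<kappa> - u) = p(u) c(u) I\<close>, that is, \<open>M(u) = p(u) c(u) X(\<kappa> - u)\<close>.

  On the other hand, by the formula for \<open>p(u)\<close> the symmetry relation is \<open>M(u) = p(u) X(\<kappa> - u)\<close>
  with its terms rearranged. In a quotient the two sides therefore agree if \<open>c(u) = 1\<close>; conversely,
  if they agree then multiplication by \<open>X\<inverse>(\<kappa> - u)\<close> gives \<open>p(u) c(u) = p(u)\<close>, and \<open>p(u)\<close> can be
  cancelled because it is a nonzero scalar series: its constant term is \<open>\<plusminus>1\<close>.

  The product formula is \<open>Q_X1_R\<close>, its consequence for \<open>c(u)\<close> is \<open>c_series_contraction\<close>, the rearrangement is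
  \<open>symmetry_defect\<close>, and \<open>pfun_nonzero\<close> allows the cancellation. The remaining work is to carry these
  identities from the free algebra to its quotients: equality in a quotient is expressed as
  coefficientwise congruence modulo an ideal of the free algebra, and one needs that
  this congruence respects sums, products and the substitution of \<open>\<kappa> - u\<close> for \<open>u\<close>.
\<close>

section \<open>Scalar series are central\<close>

lemma sc_1 [simp]: "sc 1 = 1"
  by (simp add: sc_def)

lemma sc_add: "sc (x + y) = sc x + sc y"
  by (simp add: sc_def single_add)

lemma sc_diff: "sc (x - y) = sc x - sc y"
  by (simp add: sc_def single_diff)

lemma sc_mult: "sc (x * y) = sc x * sc y"
  by (simp add: sc_def mult_single)

lemma sc_sum: "sc (\<Sum>i\<in>A. f i) = (\<Sum>i\<in>A. sc (f i))"
  by (induction A rule: infinite_finite_induct) (simp_all add: sc_add)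

lemma sc_eq_0_iff [simp]: "sc x = 0 \<longleftrightarrow> x = 0"
  unfolding sc_def by (metis lookup_single_eq lookup_zero single_zero)

lemma sc_central: "sc z * a = a * sc z"
proof (induction a rule: update_induct)
  case const
  show ?case by simp
next
  case (update f w b)
  have upd: "Poly_Mapping.update w b f = Poly_Mapping.single w b + f"
    using update(1)
    by (intro poly_mapping_eqI) (auto simp: lookup_update lookup_add lookup_single when_def in_keys_iff)
  show ?case
    unfolding upd distrib_left distrib_right update(3) by (simp add: sc_def mult_single mult.commute)
qed

lemma fls_subdegree_emb [simp]: "fls_subdegree (emb f) = fls_subdegree f"
proof (cases "f = 0")
  case False
  thus ?thesis by (intro fls_subdegree_eqI) auto
qed simp

lemma emb_add: "emb (f + g) = emb f + emb g"
  by (rule fls_eqI) (simp add: sc_add)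

lemma emb_diff: "emb (f - g) = emb f - emb g"
  by (rule fls_eqI) (simp add: sc_diff)

lemma emb_1 [simp]: "emb 1 = 1"
  by (rule fls_eqI) simp

lemma emb_mult: "emb (f * g) = emb f * emb g"
  by (rule fls_eqI) (simp add: fls_times_nth(2) sc_sum sc_mult)

lemma emb_central: "emb f * g = g * emb f"
proof (rule fls_eqI)
  fix n
  show "(emb f * g) $$ n = (g * emb f) $$ n"
    unfolding fls_times_nth(2)
    by (rule sum.reindex_bij_witness[where i = "\<lambda>k. n - k" and j = "\<lambda>k. n - k"])
       (auto simp: sc_central)
qed

section \<open>Substitution of a central series\<close>

lemma fps_power_central:
  fixes g :: "'a::ring_1 fps"
  assumes "\<And>n x. g $ n * x = x * g $ n"
  shows "(g ^ k) $ n * x = x * (g ^ k) $ n"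
proof (induction k arbitrary: n)
  case (Suc k)
  have "g $ i * g ^ k $ (n - i) * x = x * (g $ i * g ^ k $ (n - i))" for i
    by (metis Suc assms mult.assoc)
  thus ?case by (simp add: fps_mult_nth sum_distrib_left sum_distrib_right)
qed auto

text \<open>Substitution is multiplicative over a noncommutative ring only because the powers of the
  substituted series can be moved past the coefficients. Its vanishing constant term lets all the
  sums involved be extended to the common range \<open>{0..n}\<close>.\<close>

lemma fps_compose_mult_distrib_central:
  fixes f h g :: "'a::ring_1 fps"
  assumes g0: "g $ 0 = 0" and central: "\<And>n x. g $ n * x = x * g $ n"
  shows "(f * h) oo g = (f oo g) * (h oo g)"
proof (rule fps_ext)
  fix n
  have vanish: "g ^ i $ m = 0" if "m < i" for i m
    using that startsby_zero_power_prefix[OF g0] by blast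
  have extend: "(f oo g) $ m = (\<Sum>i=0..n. f $ i * g ^ i $ m)" if "m \<le> n" for m and f :: "'a fps"
    unfolding fps_compose_nth using that by (intro sum.mono_neutral_left) (auto simp: vanish)
  have "((f oo g) * (h oo g)) $ n
      = (\<Sum>m=0..n. (\<Sum>i=0..n. f $ i * g ^ i $ m) * (\<Sum>j=0..n. h $ j * g ^ j $ (n - m)))"
    unfolding fps_mult_nth by (intro sum.cong refl arg_cong2[where f = "(*)"] extend) auto
  also have "\<dots> = (\<Sum>m=0..n. \<Sum>i=0..n. \<Sum>j=0..n. f $ i * h $ j * (g ^ i $ m * g ^ j $ (n - m)))"
    unfolding sum_product
    by (intro sum.cong refl) (metis fps_power_central[OF central] mult.assoc)
  also have "\<dots> = (\<Sum>i=0..n. \<Sum>m=0..n. \<Sum>j=0..n. f $ i * h $ j * (g ^ i $ m * g ^ j $ (n - m)))"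
    by (rule sum.swap)
  also have "\<dots> = (\<Sum>i=0..n. \<Sum>j=0..n. \<Sum>m=0..n. f $ i * h $ j * (g ^ i $ m * g ^ j $ (n - m)))"
    by (intro sum.cong refl sum.swap)
  also have "\<dots> = (\<Sum>i=0..n. \<Sum>j=0..n. f $ i * h $ j * g ^ (i + j) $ n)"
    by (simp add: power_add fps_mult_nth sum_distrib_left)
  also have "\<dots> = (\<Sum>(i,j)\<in>{0..n}\<times>{0..n}. f $ i * h $ j * g ^ (i + j) $ n)"
    by (rule sum.cartesian_product)
  \<comment> \<open>Terms with \<open>i + j > n\<close> vanish; the others are sorted by the total degree \<open>k = i + j\<close>.\<close>
  also have "\<dots> = (\<Sum>(i,j)\<in>{(i,j). i + j \<le> n}. f $ i * h $ j * g ^ (i + j) $ n)"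
    by (intro sum.mono_neutral_right) (auto intro!: leI simp: vanish)
  also have "\<dots> = (\<Sum>(k,i)\<in>Sigma {0..n} (\<lambda>k. {0..k}). f $ i * h $ (k - i) * g ^ k $ n)"
    by (rule sum.reindex_bij_witness[where i = "\<lambda>(k,i). (i, k - i)" and j = "\<lambda>(i,j). (i + j, i)"]) auto
  also have "\<dots> = ((f * h) oo g) $ n"
    by (simp add: fps_compose_nth fps_mult_nth sum_distrib_right sum.Sigma)
  finally show "((f * h) oo g) $ n = ((f oo g) * (h oo g)) $ n" by simp
qed

section \<open>The rational functions of the spectral parameter\<close>

lemma pm_const: "(pm T :: complex fls) = fls_const (pm T)"
  by (simp add: pm_def)

lemma kappa_const: "(kappa T :: complex fls) = fls_const (kappa T)"
  by (simp add: kappa_def pm_const fls_of_nat fls_const_divide_const fls_minus_const flip: fls_const_numeral)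

text \<open>As \<open>fls_X_inv\<close> stands for \<open>u\<close>, these series are the polynomials \<open>a u + b\<close> of degree one, which
  have a pole of order one at \<open>u = \<infinity>\<close>; division by them raises the order of vanishing there.\<close>

lemma linear_subdegree:
  fixes a b :: complex
  assumes "a \<noteq> 0"
  shows "fls_subdegree (fls_const b + fls_const a * fls_X_inv) = -1"
    and "fls_const b + fls_const a * fls_X_inv \<noteq> 0"
proof -
  have c: "(fls_const b + fls_const a * fls_X_inv) $$ (-1) \<noteq> 0"
    using assms by (simp add: fls_X_inv_times_conv_shift)
  thus sub: "fls_subdegree (fls_const b + fls_const a * fls_X_inv) = -1"
    by (rule fls_subdegree_eqI) (simp add: fls_X_inv_times_conv_shift)
  show "fls_const b + fls_const a * fls_X_inv \<noteq> 0"
    using sub by (metis fls_zero_subdegree neg_equal_0_iff_equal zero_neq_one)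
qed

lemma divide_linear_nth:
  fixes a b :: complex
  assumes "a \<noteq> 0" "k \<le> fls_subdegree f"
  shows "(f / (fls_const b + fls_const a * fls_X_inv)) $$ k = 0"
  using assms by (intro fls_divide_nth_below) (simp add: linear_subdegree)

lemma fls_const_sum: "fls_const (\<Sum>i\<in>A. f i) = (\<Sum>i\<in>A. fls_const (f i))"
  by (rule fls_eqI) (simp add: fls_sum_nth)

lemma gmat_const: "(gmat T a b :: complex fls) = fls_const (gmat T a b)"
proof -
  have m: "(munit i j a b :: complex fls) = fls_const (munit i j a b)" for i j
    by (simp add: munit_def)
  have o: "(mone a b :: complex fls) = fls_const (mone a b)"
    by (simp add: mone_def)
  show ?thesis
    by (cases T)
      (simp_all add: m o fls_const_sum flip: fls_minus_const fls_plus_const)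
qed

text \<open>\<open>\<G>(u)\<close> is regular at \<open>u = \<infinity>\<close>: where it is not constant, the entries of the
  numerator of \<open>(I - c u \<G>) / (1 - c u)\<close> have at most the degree of the denominator.\<close>

lemma gser_subdegree: "fls_subdegree (gser T fls_X_inv a b :: complex fls) \<ge> 0"
proof -
  have pq: "fls_subdegree (gser_pq S p q fls_X_inv a b :: complex fls) \<ge> 0" for S p q
  proof (cases "p > q")
    case True
    define c :: complex where "c = 4 / (of_nat p - of_nat q)"
    have c: "c \<noteq> 0" using True by (simp add: c_def)
    have cf: "4 / (of_nat p - of_nat q) = fls_const c"
      by (simp add: c_def fls_of_nat fls_minus_const fls_const_divide_const flip: fls_const_numeral)
    define num where "num = mone a b - fls_const c * fls_X_inv * (gmat S a b :: complex fls)"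
    have g: "gser_pq S p q fls_X_inv a b = num / (fls_const 1 + fls_const (- c) * fls_X_inv)"
      using True by (simp add: gser_pq_def Let_def cf num_def)
    have "-1 \<le> fls_subdegree num"
    proof (cases "num = 0")
      case False
      moreover have "num $$ k = 0" if "k < -1" for k
        using that by (simp add: num_def mone_def gmat_const mult.assoc fls_X_inv_times_conv_shift)
      ultimately show ?thesis by (intro fls_subdegree_geI) auto
    qed simp
    thus ?thesis unfolding g using c
      by (intro fls_subdegree_ge0I divide_linear_nth) auto
  qed (simp add: gser_pq_def gmat_const)
  show ?thesis by (cases T) (simp_all add: gmat_const pq del: gmat.simps)
qed

text \<open>Both fractions in \<open>p(u)\<close> vanish at \<open>u = \<infinity>\<close>, the second one because \<open>tr(\<G>(u))\<close> is regular
  there. What remains of the value at infinity is the sign \<open>(\<plusminus>)1\<close>.\<close>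

lemma pfun_nonzero: "pfun T fls_X_inv \<noteq> (0 :: complex fls)"
proof -
  have two: "2 * fls_X_inv - fls_const x = fls_const (- x) + fls_const 2 * fls_X_inv" for x :: complex
    by simp
  have tr: "0 \<le> fls_subdegree (mtrace (idx T) (gser T fls_X_inv) :: complex fls)"
    by (rule fls_subdegree_ge0I)
      (simp add: mtrace_def fls_sum_nth less_le_trans[OF _ gser_subdegree])
  have "(pm T / (2 * fls_X_inv - kappa T) :: complex fls) $$ 0 = 0"
    unfolding kappa_const two by (rule divide_linear_nth) (simp_all add: pm_const)
  moreover have "(mtrace (idx T) (gser T fls_X_inv) / (2 * fls_X_inv - 2 * kappa T) :: complex fls) $$ 0 = 0"
    using divide_linear_nth[of 2 0 _ "- 2 * kappa T", OF _ tr]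
    by (simp add: kappa_const flip: fls_const_mult_const)
  moreover have "(bpm T :: complex fls) $$ 0 \<noteq> 0"
    by (simp add: bpm_def split: pair_type.split)
  ultimately have "pfun T (fls_X_inv :: complex fls) $$ 0 \<noteq> 0"
    by (simp add: pfun_def)
  thus ?thesis by force
qed

section \<open>Matrix algebra and the contraction with \<open>Q\<close>\<close>

lemma idx_finite [simp]: "finite (idx T)"
  by (simp add: idx_def Let_def)

lemma idx_uminus_iff [simp]: "- i \<in> idx T \<longleftrightarrow> i \<in> idx T"
  by (auto simp: idx_def Let_def)

lemma one_in_idx: "valid_pair T \<Longrightarrow> 1 \<in> idx T"
  by (cases T) (auto simp: idx_def Let_def split: if_splits)

lemma idx_nonzero: "valid_pair T \<Longrightarrow> \<not> orthogonal T \<Longrightarrow> i \<in> idx T \<Longrightarrow> i \<noteq> 0"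
  by (cases T) (auto simp: idx_def Let_def)

lemma Pmat_nth:
  assumes "r \<in> idx2 T" "s \<in> idx2 T"
  shows "Pmat T r s = (if fst r = snd s \<and> snd r = fst s then 1 else 0)"
proof -
  define z :: 'a where "z = (if fst r = snd s \<and> snd r = fst s then 1 else 0)"
  have "Pmat T r s = (\<Sum>i\<in>idx T. \<Sum>j\<in>idx T. if j = fst s then if i = fst r then z else 0 else 0)"
    unfolding Pmat_def by (intro sum.cong) (auto simp: tens_def munit_def z_def)
  also have "\<dots> = z"
    using assms by (auto simp: idx2_def)
  finally show ?thesis by (simp add: z_def)
qed

lemma Qmat_nth:
  assumes "r \<in> idx2 T" "s \<in> idx2 T"
  shows "Qmat T r s = (if snd r = - fst r \<and> snd s = - fst s then theta T (fst r) (fst s) else 0)"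
proof -
  define z :: 'a where
    "z = (if snd r = - fst r \<and> snd s = - fst s then theta T (fst r) (fst s) else 0)"
  have "Qmat T r s = (\<Sum>i\<in>idx T. \<Sum>j\<in>idx T. if j = fst s then if i = fst r then z else 0 else 0)"
    unfolding Qmat_def by (intro sum.cong) (auto simp: tens_def munit_def z_def)
  also have "\<dots> = z"
    using assms by (auto simp: idx2_def)
  finally show ?thesis by (simp add: z_def)
qed

lemma emb_theta: "emb (theta T i j) = theta T i j"
proof (cases "orthogonal T")
  case False
  thus ?thesis by (cases i "0::int" rule: linorder_cases; cases j "0::int" rule: linorder_cases)
     (simp_all add: theta_def emb_diff[of 0, simplified])
qed (simp add: theta_def)

lemma emb_pm: "emb (pm T) = pm T"
  by (simp add: pm_def emb_diff[of 0 1, simplified])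

lemma emb_bpm: "emb (bpm T) = bpm T"
  by (simp add: bpm_def emb_diff[of 0 1, simplified] split: pair_type.split)

lemma emb_mone: "emb (mone r s) = mone r s"
  by (simp add: mone_def)

lemma theta_central: "theta T i j * f = f * (theta T i j :: galg fls)"
  by (metis emb_theta emb_central)

text \<open>In the symplectic case \<open>\<theta>\<close> is a product of signs, and the index in the middle cancels because
  \<open>0\<close> is not an index there.\<close>

lemma theta_mult:
  assumes "valid_pair T" "j \<in> idx T"
  shows "theta T i j * theta T j k = theta T i k"
proof (cases "orthogonal T")
  case False
  hence "sgn j * sgn j = 1"
    using idx_nonzero[OF assms(1) False assms(2)] by (simp add: sgn_if)
  hence "sgn i * sgn j * (sgn j * sgn k) = sgn i * sgn k"
    by (metis mult.assoc mult.right_neutral)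
  thus ?thesis using False unfolding theta_def by (simp only: if_False flip: of_int_mult)
qed (simp add: theta_def)

lemma theta_neg_same:
  assumes "valid_pair T" "i \<in> idx T"
  shows "theta T (- i) i = pm T"
  using idx_nonzero[OF assms(1) _ assms(2)] by (auto simp: theta_def pm_def sgn_if)

lemma theta_same:
  assumes "valid_pair T" "i \<in> idx T"
  shows "theta T i i = 1"
  using idx_nonzero[OF assms(1) _ assms(2)] by (auto simp: theta_def sgn_if)

lemma theta_commute: "theta T i j = theta T j i"
  by (simp add: theta_def mult.commute)

lemma emb_Rmat:
  assumes "r \<in> idx2 T" "s \<in> idx2 T"
  shows "emb (Rmat T w r s) = mone r s - emb (1 / w) * Pmat T r s + emb (1 / (w - kappa T)) * Qmat T r s"
proof -
  have "Rmat T w r s = mone r s - 1 / w * Pmat T r s + 1 / (w - kappa T) * Qmat T r s"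
    by (simp add: Rmat_def)
  moreover have "emb (Pmat T r s) = Pmat T r s" "emb (Qmat T r s) = Qmat T r s"
    using assms by (simp_all add: Pmat_nth Qmat_nth emb_theta)
  ultimately show ?thesis by (simp only: emb_add emb_diff emb_mult emb_mone)
qed

lemma mmul_assoc: "mmul S (mmul S A B) C = mmul S A (mmul S B C)"
proof (intro ext)
  fix a b
  show "mmul S (mmul S A B) C a b = mmul S A (mmul S B C) a b"
    unfolding mmul_def sum_distrib_left sum_distrib_right mult.assoc by (rule sum.swap)
qed

lemma mmul_scalar_left:
  assumes "finite S" "i \<in> S"
  shows "mmul S (\<lambda>a b. x * mone a b) A i j = x * A i j"
proof -
  have "mmul S (\<lambda>a b. x * mone a b) A i j = (\<Sum>r\<in>S. if r = i then x * A i j else 0)"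
    unfolding mmul_def by (intro sum.cong) (auto simp: mone_def)
  thus ?thesis using assms by simp
qed

lemma mmul_mone_right:
  assumes "finite S" "j \<in> S"
  shows "mmul S A mone i j = A i j"
proof -
  have "mmul S A mone i j = (\<Sum>r\<in>S. if r = j then A i j else 0)"
    unfolding mmul_def by (intro sum.cong) (auto simp: mone_def)
  thus ?thesis using assms by simp
qed

lemma mmul_idx2: "mmul (idx2 T) A B r s = (\<Sum>a\<in>idx T. \<Sum>b\<in>idx T. A r (a, b) * B (a, b) s)"
  by (simp add: mmul_def idx2_def sum.cartesian_product)

lemma mmul_first_factor:
  assumes "b \<in> idx T"
  shows "mmul (idx2 T) (tens X mone) B (a, b) s = (\<Sum>k\<in>idx T. X a k * B (k, b) s)"
proof -
  have "mmul (idx2 T) (tens X mone) B (a, b) s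
      = (\<Sum>k\<in>idx T. \<Sum>h\<in>idx T. if h = b then X a k * B (k, b) s else 0)"
    unfolding mmul_idx2 by (intro sum.cong) (auto simp: tens_def mone_def)
  thus ?thesis using assms by simp
qed

lemma mmul_second_factor:
  assumes "a \<in> idx T"
  shows "mmul (idx2 T) A (tens mone Z) r (a, b) = (\<Sum>k\<in>idx T. A r (a, k) * Z k b)"
proof -
  have "mmul (idx2 T) A (tens mone Z) r (a, b)
      = (\<Sum>h\<in>idx T. if h = a then \<Sum>k\<in>idx T. A r (a, k) * Z k b else 0)"
    unfolding mmul_idx2 by (intro sum.cong) (auto simp: tens_def mone_def)
  thus ?thesis using assms by simp
qed

lemma mmul_Qmat:
  assumes "a \<in> idx T"
  shows "mmul (idx2 T) (Qmat T) B (a, - a) s = (\<Sum>k\<in>idx T. theta T a k * B (k, - k) s)"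
proof -
  have "mmul (idx2 T) (Qmat T) B (a, - a) s
      = (\<Sum>k\<in>idx T. \<Sum>h\<in>idx T. if h = - k then theta T a k * B (k, - k) s else 0)"
    unfolding mmul_idx2 using assms by (intro sum.cong) (auto simp: Qmat_nth idx2_def)
  thus ?thesis by simp
qed

text \<open>This matrix, placed in the second tensor factor, is what remains of \<open>X\<^sub>1 R(w)\<close> when \<open>Q\<close> is applied
  on the left.\<close>

definition contraction :: "pair_type \<Rightarrow> complex fls \<Rightarrow> (int \<Rightarrow> int \<Rightarrow> galg fls) \<Rightarrow> int \<Rightarrow> int \<Rightarrow> galg fls" where
  "contraction T w X i j = mtransp T X i j - pm T * emb (1 / w) * X i j
     + emb (1 / (w - kappa T)) * mtrace (idx T) X * mone i j"

text \<open>This is \<open>Q X\<^sub>1 R(w) = Q M\<^sub>2\<close> for the contraction \<open>M\<close> of \<open>X\<close>. All nonzero rows of \<open>Q\<close> are indexed by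
  pairs \<open>(-i, i)\<close> and are proportional to each other, and the row \<open>(-i, i)\<close> of \<open>Q M\<^sub>2\<close> has entry \<open>M\<^sub>i\<^sub>j\<close> in
  column \<open>(-i, j)\<close>. Hence it suffices to look at these entries. The three
  summands of \<open>R(w)\<close> contribute the transpose, \<open>X\<close> itself and the trace.\<close>

lemma Q_X1_R:
  fixes X :: "int \<Rightarrow> int \<Rightarrow> galg fls"
  assumes T: "valid_pair T" and i: "i \<in> idx T" and j: "j \<in> idx T"
  shows "mmul (idx2 T) (Qmat T) (mmul (idx2 T) (tens X mone) (\<lambda>r s. emb (Rmat T w r s))) (- i, i) (- i, j)
       = contraction T w X i j"
proof -
  define v v' where "v = emb (1 / w)" and "v' = emb (1 / (w - kappa T))"
  have v_central: "x * (v * y) = v * (x * y)" "x * (v' * y) = v' * (x * y)" for x y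
    unfolding v_def v'_def by (metis emb_central mult.assoc)+
  have theta_sq: "theta T (- i) k * theta T k (- i) = (1 :: galg fls)" if "k \<in> idx T" for k
    using theta_mult[OF T that, of "- i" "- i", where 'a = "galg fls"]
      theta_same[OF T, of "- i", where 'a = "galg fls"] i by simp
  \<comment> \<open>Only the rows \<open>(k, -k)\<close> of \<open>X\<^sub>1 R(w)\<close> survive multiplication by \<open>Q\<close>.\<close>
  have inner: "mmul (idx2 T) (tens X mone) (\<lambda>r s. emb (Rmat T w r s)) (k, - k) (- i, j)
      = (if k = - j then X k (- i) else 0) - (if k = i then v * X k j else 0)
        + v' * (mone i j * (X k k * theta T k (- i)))" if k: "k \<in> idx T" for k
  proof -
    have "mmul (idx2 T) (tens X mone) (\<lambda>r s. emb (Rmat T w r s)) (k, - k) (- i, j)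
      = (\<Sum>h\<in>idx T. X k h * emb (Rmat T w (h, - k) (- i, j)))"
      using k by (simp add: mmul_first_factor)
    also have "\<dots> = (\<Sum>h\<in>idx T. (if h = - i then if k = - j then X k (- i) else 0 else 0)
       - (if h = j then if k = i then v * X k j else 0 else 0)
       + (if h = k then v' * (mone i j * (X k k * theta T k (- i))) else 0))"
    proof (intro sum.cong refl)
      fix h assume h: "h \<in> idx T"
      have "X k h * emb (Rmat T w (h, - k) (- i, j)) = X k h * mone (h, - k) (- i, j)
         - v * (X k h * Pmat T (h, - k) (- i, j)) + v' * (X k h * Qmat T (h, - k) (- i, j))"
        using h k i j by (simp add: emb_Rmat idx2_def v_central distrib_left right_diff_distrib
           flip: v_def v'_def)
      thus "X k h * emb (Rmat T w (h, - k) (- i, j))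
         = (if h = - i then if k = - j then X k (- i) else 0 else 0)
         - (if h = j then if k = i then v * X k j else 0 else 0)
         + (if h = k then v' * (mone i j * (X k k * theta T k (- i))) else 0)"
        using h k i j by (auto simp: idx2_def mone_def Pmat_nth Qmat_nth)
    qed
    finally show ?thesis
      using i j k by (simp add: sum.distrib sum_subtractf)
  qed
  have "mmul (idx2 T) (Qmat T) (mmul (idx2 T) (tens X mone) (\<lambda>r s. emb (Rmat T w r s))) (- i, i) (- i, j)
    = (\<Sum>k\<in>idx T. theta T (- i) k
        * mmul (idx2 T) (tens X mone) (\<lambda>r s. emb (Rmat T w r s)) (k, - k) (- i, j))"
    using mmul_Qmat[of "- i" T, where 'a = "galg fls"] i by simp
  also have "\<dots> = (\<Sum>k\<in>idx T. theta T (- i) k * ((if k = - j then X k (- i) else 0)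
        - (if k = i then v * X k j else 0) + v' * (mone i j * (X k k * theta T k (- i)))))"
    by (intro sum.cong refl arg_cong2[where f = "(*)"] inner)
  also have "\<dots> = (\<Sum>k\<in>idx T. (if k = - j then theta T (- i) (- j) * X (- j) (- i) else 0)
        - (if k = i then pm T * v * X i j else 0) + v' * (X k k * mone i j))"
  proof (intro sum.cong refl)
    fix k assume k: "k \<in> idx T"
    have "theta T (- i) k * (mone i j * (X k k * theta T k (- i)))
        = theta T (- i) k * theta T k (- i) * (X k k * mone i j)"
      unfolding theta_central[of T k "- i" "X k k", symmetric] by (simp add: mone_def mult.assoc)
    thus "theta T (- i) k * ((if k = - j then X k (- i) else 0)
        - (if k = i then v * X k j else 0) + v' * (mone i j * (X k k * theta T k (- i))))
      = (if k = - j then theta T (- i) (- j) * X (- j) (- i) else 0)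
        - (if k = i then pm T * v * X i j else 0) + v' * (X k k * mone i j)"
      unfolding distrib_left right_diff_distrib v_central theta_sq[OF k]
      using theta_neg_same[OF T i, where 'a = "galg fls"] by (auto simp: mult.assoc)
  qed
  also have "\<dots> = contraction T w X i j"
    using i j by (simp add: sum.distrib sum_subtractf contraction_def mtransp_def mtrace_def
        theta_commute[of T "- j"] sum_distrib_left sum_distrib_right mult.assoc v_def v'_def)
  finally show ?thesis .
qed

lemma Q_X1_R_Z2:
  fixes X Z :: "int \<Rightarrow> int \<Rightarrow> galg fls"
  assumes T: "valid_pair T" and i: "i \<in> idx T" and j: "j \<in> idx T"
  shows "mmul (idx2 T) (Qmat T) (mmul (idx2 T) (tens X mone)
           (mmul (idx2 T) (\<lambda>r s. emb (Rmat T w r s)) (tens mone Z))) (- i, i) (- i, j)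
       = mmul (idx T) (contraction T w X) Z i j"
proof -
  have "mmul (idx2 T) (Qmat T) (mmul (idx2 T) (tens X mone)
           (mmul (idx2 T) (\<lambda>r s. emb (Rmat T w r s)) (tens mone Z))) (- i, i) (- i, j)
      = mmul (idx2 T) (mmul (idx2 T) (Qmat T) (mmul (idx2 T) (tens X mone) (\<lambda>r s. emb (Rmat T w r s))))
          (tens mone Z) (- i, i) (- i, j)"
    by (simp only: mmul_assoc)
  also have "\<dots> = (\<Sum>k\<in>idx T. mmul (idx2 T) (Qmat T)
      (mmul (idx2 T) (tens X mone) (\<lambda>r s. emb (Rmat T w r s))) (- i, i) (- i, k) * Z k j)"
    using i by (simp add: mmul_second_factor)
  also have "\<dots> = mmul (idx T) (contraction T w X) Z i j"
    unfolding mmul_def[of "idx T"] by (intro sum.cong refl arg_cong2[where f = "(*)"] Q_X1_R T i)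
  finally show ?thesis .
qed

section \<open>Congruence of series modulo an ideal of the free algebra\<close>

locale free_alg_ideal =
  fixes T :: pair_type and K :: "galg set"
  assumes ideal_K: "ideal K (free_alg T)"
begin

lemma K_zero: "0 \<in> K"
  using additive_subgroup.zero_closed[OF ideal.axioms(1)[OF ideal_K]] by (simp add: free_alg_simps)

lemma K_add: "a \<in> K \<Longrightarrow> b \<in> K \<Longrightarrow> a + b \<in> K"
  using additive_subgroup.a_closed[OF ideal.axioms(1)[OF ideal_K]] by (simp add: free_alg_simps)

lemma K_mult_left: "a \<in> K \<Longrightarrow> x \<in> carrier (free_alg T) \<Longrightarrow> x * a \<in> K"
  using ideal.I_l_closed[OF ideal_K] by (simp add: free_alg_simps)

lemma K_mult_right: "a \<in> K \<Longrightarrow> x \<in> carrier (free_alg T) \<Longrightarrow> a * x \<in> K"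
  using ideal.I_r_closed[OF ideal_K] by (simp add: free_alg_simps)

lemma K_uminus: "a \<in> K \<Longrightarrow> - a \<in> K"
  using K_mult_left[of a "- 1"] by (simp add: free_alg_closed)

lemma K_sum: "(\<And>a. a \<in> A \<Longrightarrow> f a \<in> K) \<Longrightarrow> (\<Sum>a\<in>A. f a) \<in> K"
  by (induction A rule: infinite_finite_induct) (auto simp: K_zero K_add)

text \<open>The ideal absorbs factors from the free algebra only, not from all of \<open>galg\<close>; membership of the
  coefficients is therefore made part of the congruence, which then is compatible with
  products without side conditions.\<close>

definition cong :: "galg fls \<Rightarrow> galg fls \<Rightarrow> bool" where
  "cong f g \<longleftrightarrow> (\<forall>k. f $$ k \<in> carrier (free_alg T) \<and> g $$ k \<in> carrier (free_alg T) \<and> (f - g) $$ k \<in> K)"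

lemma cong_refl: "(\<And>k. f $$ k \<in> carrier (free_alg T)) \<Longrightarrow> cong f f"
  by (simp add: cong_def K_zero)

lemma cong_sym: "cong f g \<Longrightarrow> cong g f"
  unfolding cong_def using K_uminus by fastforce

lemma cong_trans:
  assumes "cong f g" "cong g h"
  shows "cong f h"
proof -
  have "(f - h) $$ k \<in> K" for k
    using assms K_add[of "(f - g) $$ k" "(g - h) $$ k"] by (simp add: cong_def)
  thus ?thesis using assms by (simp add: cong_def)
qed

lemma cong_add:
  assumes "cong f f'" "cong g g'"
  shows "cong (f + g) (f' + g')"
proof -
  have "(f + g) - (f' + g') = (f - f') + (g - g')" by simp
  hence "((f + g) - (f' + g')) $$ k \<in> K" for k
    using assms K_add by (metis cong_def fls_plus_nth)
  thus ?thesis using assms by (auto simp: cong_def free_alg_closed)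
qed

lemma cong_diff:
  assumes "cong f f'" "cong g g'"
  shows "cong (f - g) (f' - g')"
proof -
  have "(f - g) - (f' - g') = (f - f') + (- (g - g'))" by simp
  hence "((f - g) - (f' - g')) $$ k \<in> K" for k
    using assms K_add K_uminus by (metis cong_def fls_plus_nth fls_uminus_nth)
  thus ?thesis using assms by (auto simp: cong_def free_alg_closed)
qed

lemma cong_mult:
  assumes "cong f f'" "cong g g'"
  shows "cong (f * g) (f' * g')"
proof -
  have "f * g - f' * g' = f * (g - g') + (f - f') * g'"
    by (simp add: algebra_simps)
  moreover have elem: "f $$ k \<in> carrier (free_alg T)" "g' $$ k \<in> carrier (free_alg T)"
    "(f - f') $$ k \<in> K" "(g - g') $$ k \<in> K" for k
    using assms unfolding cong_def by blast+
  moreover have "(f * (g - g')) $$ k \<in> K" "((f - f') * g') $$ k \<in> K" for k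
    unfolding fls_times_nth(2) by (intro K_sum K_mult_left K_mult_right elem)+
  ultimately have "(f * g - f' * g') $$ k \<in> K" for k
    by (metis K_add fls_plus_nth)
  moreover have "(f * g) $$ k \<in> carrier (free_alg T)" "(f' * g') $$ k \<in> carrier (free_alg T)" for k
    by (rule fls_times_carrier; use assms in \<open>simp add: cong_def\<close>)+
  ultimately show ?thesis by (simp add: cong_def)
qed

lemma cong_sum: "(\<And>a. a \<in> A \<Longrightarrow> cong (f a) (g a)) \<Longrightarrow> cong (\<Sum>a\<in>A. f a) (\<Sum>a\<in>A. g a)"
  by (induction A rule: infinite_finite_induct) (auto simp: cong_add cong_refl free_alg_closed)

lemma cong_emb: "cong (emb f) (emb f)"
  by (rule cong_refl) (simp add: free_alg_closed)

definition mcong :: "(int \<Rightarrow> int \<Rightarrow> galg fls) \<Rightarrow> (int \<Rightarrow> int \<Rightarrow> galg fls) \<Rightarrow> bool" where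
  "mcong A B \<longleftrightarrow> (\<forall>i\<in>idx T. \<forall>j\<in>idx T. cong (A i j) (B i j))"

lemma mcong_mmul: "mcong A A' \<Longrightarrow> mcong B B' \<Longrightarrow> mcong (mmul (idx T) A B) (mmul (idx T) A' B')"
  unfolding mcong_def mmul_def by (auto intro!: cong_sum cong_mult)

lemma mcong_trans: "mcong A B \<Longrightarrow> mcong B C \<Longrightarrow> mcong A C"
  unfolding mcong_def by (blast intro: cong_trans)

lemma mcong_sym: "mcong A B \<Longrightarrow> mcong B A"
  unfolding mcong_def by (blast intro: cong_sym)

text \<open>Each coefficient of \<open>f(\<kappa> - u)\<close> is a finite linear combination of coefficients of \<open>f\<close>.\<close>

lemma cong_at_kappa_minus_u:
  assumes "cong (at_u f) (at_u g)"
  shows "cong (at_kappa_minus_u T f) (at_kappa_minus_u T g)"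
proof -
  define s where "s = fls_regpart (emb (1 / (kappa T - fls_X_inv)))"
  have s: "(s ^ i) $ n \<in> carrier (free_alg T)" for i n
  proof (induction i arbitrary: n)
    case (Suc i)
    thus ?case
      by (auto simp: fps_mult_nth s_def free_alg_closed intro!: free_alg_closed_sum free_alg_mult_closed)
  qed (auto simp: free_alg_closed)
  have fg: "f $ n \<in> carrier (free_alg T)" "g $ n \<in> carrier (free_alg T)" "f $ n - g $ n \<in> K" for n
    using assms[unfolded cong_def, rule_format, of "int n"] by (simp_all add: at_u_def)
  have "(f oo s) $ n \<in> carrier (free_alg T)" "(g oo s) $ n \<in> carrier (free_alg T)" for n
    unfolding fps_compose_nth by (intro free_alg_closed_sum free_alg_mult_closed fg s)+
  moreover have "(f oo s) $ n - (g oo s) $ n \<in> K" for n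
    unfolding fps_compose_nth sum_subtractf[symmetric] left_diff_distrib[symmetric]
    by (intro K_sum K_mult_right fg s)
  ultimately show ?thesis
    by (simp add: cong_def at_kappa_minus_u_def free_alg_closed K_zero flip: s_def)
qed

text \<open>Multiply the first relation by \<open>C\<close> on the right. This will be applied to the contraction \<open>A\<close> of
  \<open>X(u)\<close>, with \<open>B\<close> the inverse of \<open>C = X(\<kappa> - u)\<close> and \<open>x = p(u) c(u)\<close>.\<close>

lemma mcong_solve:
  assumes AB: "mcong (mmul (idx T) A B) (\<lambda>i j. x * mone i j)" and BC: "mcong (mmul (idx T) B C) mone"
    and A: "mcong A A" and C: "mcong C C"
  shows "mcong A (\<lambda>i j. x * C i j)"
proof -
  have "mcong (mmul (idx T) A (mmul (idx T) B C)) (mmul (idx T) A mone)"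
    by (rule mcong_mmul[OF A BC])
  hence 1: "mcong (mmul (idx T) A (mmul (idx T) B C)) A"
    by (simp add: mcong_def mmul_mone_right)
  have "mcong (mmul (idx T) (mmul (idx T) A B) C) (mmul (idx T) (\<lambda>i j. x * mone i j) C)"
    by (rule mcong_mmul[OF AB C])
  hence 2: "mcong (mmul (idx T) A (mmul (idx T) B C)) (\<lambda>i j. x * C i j)"
    by (simp add: mcong_def mmul_scalar_left mmul_assoc)
  from mcong_trans[OF mcong_sym[OF 1] 2] show ?thesis .
qed

end

lemma cong_mono:
  assumes "free_alg_ideal T K" "free_alg_ideal T L" "K \<subseteq> L" "free_alg_ideal.cong T K f g"
  shows "free_alg_ideal.cong T L f g"
  using assms by (auto simp: free_alg_ideal.cong_def)

text \<open>The substituted series \<open>1 / (\<kappa> - u)\<close> vanishes at \<open>u = \<infinity>\<close> and has scalar coefficients, so it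
  meets both conditions of \<open>fps_compose_mult_distrib_central\<close>.\<close>

lemma at_kappa_minus_u_mult: "at_kappa_minus_u T (f * g) = at_kappa_minus_u T f * at_kappa_minus_u T g"
proof -
  define s where "s = fls_regpart (emb (1 / (kappa T - fls_X_inv)))"
  have "(1 / (kappa T - fls_X_inv) :: complex fls) $$ 0 = 0"
    using divide_linear_nth[of "-1" 0 1 "kappa T"] by (simp add: kappa_const)
  hence "s $ 0 = 0" by (simp add: s_def)
  moreover have "s $ n * x = x * s $ n" for n x
    by (simp add: s_def sc_central)
  ultimately show ?thesis
    by (simp add: at_kappa_minus_u_def fps_compose_mult_distrib_central fls_times_fps_to_fls flip: s_def)
qed

lemma fps_to_fls_sum: "fps_to_fls (\<Sum>i\<in>A. f i) = (\<Sum>i\<in>A. fps_to_fls (f i))"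
  by (induction A rule: infinite_finite_induct) simp_all

lemma at_kappa_minus_u_mmul:
  "at_kappa_minus_u T (mmul S A B i j) = mmul S (\<lambda>i j. at_kappa_minus_u T (A i j)) (\<lambda>i j. at_kappa_minus_u T (B i j)) i j"
proof -
  have "at_kappa_minus_u T (mmul S A B i j) = (\<Sum>r\<in>S. at_kappa_minus_u T (A i r * B r j))"
    by (simp add: mmul_def at_kappa_minus_u_def fps_compose_sum_distrib fps_to_fls_sum)
  thus ?thesis by (simp add: mmul_def at_kappa_minus_u_mult)
qed

lemma at_kappa_minus_u_mone: "at_kappa_minus_u T (mone i j) = mone i j"
  by (simp add: at_kappa_minus_u_def mone_def)

lemma at_u_mmul: "at_u (mmul S A B i j) = mmul S (\<lambda>i j. at_u (A i j)) (\<lambda>i j. at_u (B i j)) i j"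
  by (simp add: mmul_def at_u_def fps_to_fls_sum fls_times_fps_to_fls)

lemma at_u_mone: "at_u (mone i j) = mone i j"
  by (simp add: at_u_def mone_def)

text \<open>As substitution commutes with matrix products, it turns the inverse of a matrix of series
  into the inverse of the substituted matrix.\<close>

lemma (in free_alg_ideal) mcong_inverse_at_kappa_minus_u:
  assumes "mcong (mmul (idx T) (\<lambda>i j. at_u (A i j)) (\<lambda>i j. at_u (B i j))) mone"
  shows "mcong (mmul (idx T) (\<lambda>i j. at_kappa_minus_u T (A i j)) (\<lambda>i j. at_kappa_minus_u T (B i j))) mone"
  using assms unfolding mcong_def
  by (metis cong_at_kappa_minus_u at_kappa_minus_u_mmul at_kappa_minus_u_mone at_u_mmul at_u_mone)

section \<open>Quotients of the extended reflection algebra\<close>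

lemma free_alg_minus:
  assumes "a \<in> carrier (free_alg T)" "b \<in> carrier (free_alg T)"
  shows "a \<ominus>\<^bsub>free_alg T\<^esub> b = a - b"
proof -
  interpret ring "free_alg T" by (rule ring_free_alg)
  have "\<ominus>\<^bsub>free_alg T\<^esub> b = - b"
    using assms free_alg_closed(3)[of b T] by (intro minus_equality) (simp_all add: free_alg_simps)
  thus ?thesis by (simp add: a_minus_def free_alg_simps)
qed

lemma xb_proj_eq_iff:
  assumes "a \<in> carrier (free_alg T)" "b \<in> carrier (free_alg T)"
  shows "xb_proj T a = xb_proj T b \<longleftrightarrow> a - b \<in> xb_ideal T"
  using ring.quotient_eq_iff_same_a_r_cos[OF ring_free_alg ideal_xb_ideal assms] free_alg_minus[OF assms]
  by (simp add: xb_proj_def)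

text \<open>An ideal of \<open>XB T\<close> is replaced by its preimage in the free algebra, so that congruences
  in \<open>XB T\<close> and in its quotients are both congruences modulo ideals of one algebra.\<close>

definition xb_preimage :: "pair_type \<Rightarrow> galg set set \<Rightarrow> galg set" where
  "xb_preimage T J = {a \<in> carrier (free_alg T). xb_proj T a \<in> J}"

lemma xb_proj_hom: "ring_hom_ring (free_alg T) (XB T) (xb_proj T)"
  using ideal.rcos_ring_hom_ring[OF ideal_xb_ideal] by (simp add: XB_def xb_proj_def[abs_def])

lemma ideal_xb_preimage: "ideal J (XB T) \<Longrightarrow> ideal (xb_preimage T J) (free_alg T)"
  unfolding xb_preimage_def by (rule ring_hom_ring.ideal_vimage[OF xb_proj_hom])

lemma xb_ideal_subset_preimage:
  assumes "ideal J (XB T)"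
  shows "xb_ideal T \<subseteq> xb_preimage T J"
proof
  fix a assume a: "a \<in> xb_ideal T"
  hence ac: "a \<in> carrier (free_alg T)" using ideal.Icarr[OF ideal_xb_ideal] by blast
  hence "xb_proj T a = xb_proj T 0"
    using a by (subst xb_proj_eq_iff) (auto simp: free_alg_closed)
  also have "\<dots> = \<zero>\<^bsub>XB T\<^esub>"
    using ring_hom_ring.homh[OF xb_proj_hom] ring_hom_zero[OF _ ring_free_alg ring_XB]
    by (metis free_alg_simps(3))
  finally show "a \<in> xb_preimage T J"
    using ac additive_subgroup.zero_closed[OF ideal.axioms(1)[OF assms]] by (simp add: xb_preimage_def)
qed

lemma quot_proj_eq_iff:
  assumes J: "ideal J (XB T)" and ab: "a \<in> carrier (free_alg T)" "b \<in> carrier (free_alg T)"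
  shows "J +>\<^bsub>XB T\<^esub> xb_proj T a = J +>\<^bsub>XB T\<^esub> xb_proj T b \<longleftrightarrow> a - b \<in> xb_preimage T J"
proof -
  interpret h: ring_hom_ring "free_alg T" "XB T" "xb_proj T" by (rule xb_proj_hom)
  have "xb_proj T a \<ominus>\<^bsub>XB T\<^esub> xb_proj T b = xb_proj T (a - b)"
    using ab by (simp add: free_alg_minus[symmetric] h.R.minus_eq h.S.minus_eq)
  moreover have "xb_proj T a \<ominus>\<^bsub>XB T\<^esub> xb_proj T b \<in> J \<longleftrightarrow> J +>\<^bsub>XB T\<^esub> xb_proj T a = J +>\<^bsub>XB T\<^esub> xb_proj T b"
    using ab by (intro h.S.quotient_eq_iff_same_a_r_cos[OF J]) auto
  ultimately show ?thesis
    using ab free_alg_closed(5) by (auto simp: xb_preimage_def)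
qed

section \<open>The series \<open>c(u)\<close> and the symmetry relation\<close>

definition X_at_u :: "pair_type \<Rightarrow> int \<Rightarrow> int \<Rightarrow> galg fls" where
  "X_at_u T = (\<lambda>i j. at_u (Xser T i j))"

definition X_at_kappa_minus_u :: "pair_type \<Rightarrow> int \<Rightarrow> int \<Rightarrow> galg fls" where
  "X_at_kappa_minus_u T = (\<lambda>i j. at_kappa_minus_u T (Xser T i j))"

definition contracted_X :: "pair_type \<Rightarrow> int \<Rightarrow> int \<Rightarrow> galg fls" where
  "contracted_X T = contraction T (2 * fls_X_inv - kappa T) (X_at_u T)"

context free_alg_ideal
begin

lemma cong_signs:
  "cong (pm T) (pm T)" "cong (bpm T) (bpm T)" "cong (mone i j) (mone i j)"
  "cong (theta T k l) (theta T k l)"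
  using cong_emb emb_theta by (metis emb_pm emb_bpm emb_mone)+

lemma cong_at_u: "(\<And>k. f $ k \<in> carrier (free_alg T)) \<Longrightarrow> cong (at_u f) (at_u f)"
  by (intro cong_refl) (simp add: at_u_def free_alg_closed)

lemma mcong_X: "mcong (X_at_u T) (X_at_u T)"
  unfolding mcong_def X_at_u_def by (auto intro!: cong_at_u simp: Xser_def xgen_in_carrier)

lemma mcong_X_kappa: "mcong (X_at_kappa_minus_u T) (X_at_kappa_minus_u T)"
  unfolding mcong_def X_at_kappa_minus_u_def
  by (auto intro!: cong_at_kappa_minus_u cong_at_u simp: Xser_def xgen_in_carrier)

lemma cong_trace_X: "cong (mtrace (idx T) (X_at_u T)) (mtrace (idx T) (X_at_u T))"
  unfolding mtrace_def using mcong_X by (auto intro!: cong_sum simp: mcong_def)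

lemma mcong_X_transp: "mcong (mtransp T (X_at_u T)) (mtransp T (X_at_u T))"
  using mcong_X by (auto simp: mcong_def mtransp_def intro!: cong_mult cong_signs)

lemma mcong_contracted_X: "mcong (contracted_X T) (contracted_X T)"
  using mcong_X mcong_X_transp unfolding mcong_def contracted_X_def contraction_def
  by (auto intro!: cong_add cong_diff cong_mult cong_signs cong_trace_X cong_emb)

end

text \<open>The terms of the symmetry relation that contain \<open>X'\<close>, which stands for \<open>X(\<kappa> - u)\<close>, have the
  common factor \<open>p(u)\<close>; the other ones form the contraction of \<open>X(u)\<close>.\<close>

lemma symmetry_defect:
  fixes X X' :: "int \<Rightarrow> int \<Rightarrow> galg fls"
  shows "mtransp T X i j - (bpm T * X' i j
       + pm T * emb (1 / (2 * fls_X_inv - kappa T)) * (X i j - X' i j)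
       + emb (1 / (2 * fls_X_inv - 2 * kappa T)) *
          (emb (mtrace (idx T) (gser T fls_X_inv)) * X' i j - mtrace (idx T) X * mone i j))
     = contraction T (2 * fls_X_inv - kappa T) X i j - emb (pfun T fls_X_inv) * X' i j"
proof -
  define w :: "complex fls" where "w = 2 * fls_X_inv - kappa T"
  have "pfun T fls_X_inv = bpm T - pm T * (1 / w)
      + 1 / (2 * fls_X_inv - 2 * kappa T) * mtrace (idx T) (gser T fls_X_inv)"
    by (simp add: pfun_def w_def)
  hence p: "emb (pfun T fls_X_inv) = bpm T - pm T * emb (1 / w)
      + emb (1 / (2 * fls_X_inv - 2 * kappa T)) * emb (mtrace (idx T) (gser T fls_X_inv))"
    by (simp only: emb_add emb_diff emb_mult emb_pm emb_bpm)
  have w_shift: "w - kappa T = 2 * fls_X_inv - 2 * kappa T" by (simp add: w_def)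
  show ?thesis
    unfolding contraction_def w_def[symmetric] p w_shift by (simp add: algebra_simps)
qed

lemma symmetry_mod_iff:
  assumes J: "ideal J (XB T)"
  shows "symmetry_mod T J \<longleftrightarrow> free_alg_ideal.mcong T (xb_preimage T J) (contracted_X T)
           (\<lambda>i j. emb (pfun T fls_X_inv) * X_at_kappa_minus_u T i j)"
proof -
  interpret free_alg_ideal T "xb_preimage T J"
    by (rule free_alg_ideal.intro[OF ideal_xb_preimage[OF J]])
  define S where "S = (\<lambda>i j. bpm T * X_at_kappa_minus_u T i j
     + pm T * emb (1 / (2 * fls_X_inv - kappa T)) * (X_at_u T i j - X_at_kappa_minus_u T i j)
     + emb (1 / (2 * fls_X_inv - 2 * kappa T)) *
        (emb (mtrace (idx T) (gser T fls_X_inv)) * X_at_kappa_minus_u T i j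
          - mtrace (idx T) (X_at_u T) * mone i j))"
  have S: "mcong S S"
    using mcong_X mcong_X_kappa unfolding mcong_def S_def
    by (auto intro!: cong_add cong_diff cong_mult cong_signs cong_trace_X cong_emb)
  have pX: "mcong (\<lambda>i j. emb (pfun T fls_X_inv) * X_at_kappa_minus_u T i j)
      (\<lambda>i j. emb (pfun T fls_X_inv) * X_at_kappa_minus_u T i j)"
    using mcong_X_kappa by (auto simp: mcong_def intro!: cong_mult cong_emb)
  have "symmetry_mod T J
      \<longleftrightarrow> meq_via (\<lambda>a. J +>\<^bsub>XB T\<^esub> xb_proj T a) (idx T) (mtransp T (X_at_u T)) S"
    by (simp add: symmetry_mod_def Let_def S_def X_at_u_def X_at_kappa_minus_u_def)
  also have "\<dots> \<longleftrightarrow> (\<forall>i\<in>idx T. \<forall>j\<in>idx T. \<forall>k.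
      (mtransp T (X_at_u T) i j - S i j) $$ k \<in> xb_preimage T J)"
    using mcong_X_transp S by (simp add: meq_via_def mcong_def cong_def quot_proj_eq_iff[OF J])
  also have "\<dots> \<longleftrightarrow> mcong (contracted_X T)
      (\<lambda>i j. emb (pfun T fls_X_inv) * X_at_kappa_minus_u T i j)"
    unfolding S_def symmetry_defect contracted_X_def[symmetric]
    using mcong_contracted_X pX by (simp add: mcong_def cong_def)
  finally show ?thesis .
qed

lemma c_trivial_mod_iff:
  assumes J: "ideal J (XB T)"
    and d: "\<And>k. d $ k \<in> carrier (free_alg T)" and c: "\<And>k. c k = xb_proj T (d $ k)"
  shows "c_trivial_mod T J c \<longleftrightarrow> free_alg_ideal.cong T (xb_preimage T J) (at_u d) 1"
proof -
  interpret free_alg_ideal T "xb_preimage T J"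
    by (rule free_alg_ideal.intro[OF ideal_xb_preimage[OF J]])
  interpret h: ring_hom_ring "free_alg T" "XB T" "xb_proj T" by (rule xb_proj_hom)
  have one: "\<one>\<^bsub>XB T Quot J\<^esub> = J +>\<^bsub>XB T\<^esub> xb_proj T 1"
    using h.hom_one by (simp add: FactRing_def free_alg_simps)
  have "xb_proj T 0 = \<zero>\<^bsub>XB T\<^esub>"
    using h.hom_zero by (simp add: free_alg_simps)
  hence zero: "\<zero>\<^bsub>XB T Quot J\<^esub> = J +>\<^bsub>XB T\<^esub> xb_proj T 0"
    using additive_subgroup.zero_closed[OF ideal.axioms(1)[OF J]]
      abelian_subgroup.a_rcos_const[OF abelian_subgroupI3[OF ideal.axioms(1)[OF J] h.S.is_abelian_group]]
    by (simp add: FactRing_def)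
  have "c_trivial_mod T J c \<longleftrightarrow> (\<forall>k. d $ k - (if k = 0 then 1 else 0) \<in> xb_preimage T J)"
    unfolding c_trivial_mod_def c one zero
    using d by (auto simp: quot_proj_eq_iff[OF J] free_alg_closed)
  also have "\<dots> \<longleftrightarrow> (\<forall>k. (at_u d - 1) $$ k \<in> xb_preimage T J)"
  proof (intro iffI allI)
    fix k assume "\<forall>k. d $ k - (if k = 0 then 1 else 0) \<in> xb_preimage T J"
    thus "(at_u d - 1) $$ k \<in> xb_preimage T J"
      by (cases k) (auto simp: at_u_def K_zero dest: spec[of _ "nat k"])
  next
    fix k assume "\<forall>k. (at_u d - 1) $$ k \<in> xb_preimage T J"
    from this[rule_format, of "int k"] show "d $ k - (if k = 0 then 1 else 0) \<in> xb_preimage T J"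
      by (simp add: at_u_def)
  qed
  also have "\<dots> \<longleftrightarrow> cong (at_u d) 1"
    using cong_at_u[OF d] by (simp add: cong_def free_alg_closed)
  finally show ?thesis .
qed

text \<open>In the extended reflection algebra, \<open>M(u) = p(u) c(u) X(\<kappa> - u)\<close> for the contraction \<open>M(u)\<close>
  of \<open>X(u)\<close>: the contraction formula identifies the entry \<open>((-i, i), (-i, j))\<close> of the
  first defining equation of \<open>c(u)\<close> with the entry \<open>(i, j)\<close> of \<open>M(u) X\<inverse>(\<kappa> - u) = p(u) c(u) I\<close>.\<close>

lemma c_series_contraction:
  assumes T: "valid_pair T" and c: "is_c_series T c"
  obtains d Y' where "\<And>k. d $ k \<in> carrier (free_alg T)" "\<And>k. c k = xb_proj T (d $ k)"
    and "free_alg_ideal.mcong T (xb_ideal T) (mmul (idx T) (X_at_kappa_minus_u T) Y') mone"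
    and "free_alg_ideal.mcong T (xb_ideal T) Y' Y'"
    and "free_alg_ideal.mcong T (xb_ideal T) (contracted_X T)
           (\<lambda>i j. emb (pfun T fls_X_inv) * at_u d * X_at_kappa_minus_u T i j)"
proof -
  interpret free_alg_ideal T "xb_ideal T" by (rule free_alg_ideal.intro[OF ideal_xb_ideal])
  define w :: "complex fls" where "w = 2 * fls_X_inv - kappa T"
  define p where "p = emb (pfun T fls_X_inv)"
  obtain d Y where d: "\<And>k. d $ k \<in> carrier (free_alg T)" "\<And>k. c k = xb_proj T (d $ k)"
    and Y: "\<And>i j k. i \<in> idx T \<Longrightarrow> j \<in> idx T \<Longrightarrow> Y i j $ k \<in> carrier (free_alg T)"
    and XY: "meq_via (xb_proj T) (idx T) (mmul (idx T) (X_at_u T) (\<lambda>i j. at_u (Y i j))) mone"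
    and YX: "meq_via (xb_proj T) (idx T) (mmul (idx T) (\<lambda>i j. at_u (Y i j)) (X_at_u T)) mone"
    and c_eq: "meq_via (xb_proj T) (idx2 T)
       (mmul (idx2 T) (Qmat T) (mmul (idx2 T) (tens (X_at_u T) mone)
          (mmul (idx2 T) (\<lambda>r s. emb (Rmat T w r s)) (tens mone (\<lambda>i j. at_kappa_minus_u T (Y i j))))))
       (\<lambda>r s. p * at_u d * Qmat T r s)"
    using c unfolding is_c_series_def Let_def X_at_u_def w_def p_def by blast
  define Y' where "Y' = (\<lambda>i j. at_kappa_minus_u T (Y i j))"
  have Y_cong: "mcong (\<lambda>i j. at_u (Y i j)) (\<lambda>i j. at_u (Y i j))" and Y'_cong: "mcong Y' Y'"
    unfolding mcong_def Y'_def by (auto intro!: cong_at_kappa_minus_u cong_at_u Y)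
  have mone_cong: "mcong mone mone" by (simp add: mcong_def cong_signs)

  have to_cong: "cong f g"
    if "cong f f" "cong g g" "\<And>k. xb_proj T (f $$ k) = xb_proj T (g $$ k)" for f g
    using that by (auto simp: cong_def xb_proj_eq_iff)
  have to_mcong: "mcong A B"
    if "mcong A A" "mcong B B" "meq_via (xb_proj T) (idx T) A B" for A B
    using that unfolding mcong_def meq_via_def by (blast intro: to_cong[of "A _ _" "B _ _"])
  have XY': "mcong (mmul (idx T) (X_at_kappa_minus_u T) Y') mone"
    using mcong_inverse_at_kappa_minus_u[OF
        to_mcong[OF mcong_mmul[OF mcong_X Y_cong] mone_cong XY, unfolded X_at_u_def]]
    by (simp add: X_at_kappa_minus_u_def Y'_def)
  have YX': "mcong (mmul (idx T) Y' (X_at_kappa_minus_u T)) mone"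
    using mcong_inverse_at_kappa_minus_u[OF
        to_mcong[OF mcong_mmul[OF Y_cong mcong_X] mone_cong YX, unfolded X_at_u_def]]
    by (simp add: X_at_kappa_minus_u_def Y'_def)

  have MY': "mcong (mmul (idx T) (contracted_X T) Y') (\<lambda>i j. p * at_u d * mone i j)"
    unfolding mcong_def
  proof (intro ballI)
    fix i j assume i: "i \<in> idx T" and j: "j \<in> idx T"
    have "Qmat T (- i, i) (- i, j) = (mone i j :: galg fls)"
      using i j T by (simp add: Qmat_nth idx2_def theta_same mone_def)
    hence "xb_proj T (mmul (idx T) (contracted_X T) Y' i j $$ k)
        = xb_proj T ((p * at_u d * mone i j) $$ k)" for k
      using c_eq[unfolded meq_via_def, rule_format, of "(- i, i)" "(- i, j)" k] i j
        Q_X1_R_Z2[OF T i j, of "X_at_u T" w Y']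
      by (simp add: idx2_def Y'_def contracted_X_def w_def)
    moreover have "cong (mmul (idx T) (contracted_X T) Y' i j) (mmul (idx T) (contracted_X T) Y' i j)"
      using mcong_mmul[OF mcong_contracted_X Y'_cong] i j by (simp add: mcong_def)
    moreover have "cong (p * at_u d * mone i j) (p * at_u d * mone i j)"
      unfolding p_def by (intro cong_mult cong_emb cong_at_u d cong_signs)
    ultimately show "cong (mmul (idx T) (contracted_X T) Y' i j) (p * at_u d * mone i j)"
      by (rule to_cong[rotated 2])
  qed
  show ?thesis
    using that[OF d XY' Y'_cong] mcong_solve[OF MY' YX' mcong_contracted_X mcong_X_kappa]
    by (simp add: p_def)
qed

theorem theorem5p2:
  fixes T :: pair_type and c :: "nat \<Rightarrow> galg set" and J :: "galg set set"
  assumes "valid_pair T"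
    and "is_c_series T c"
    and "ideal J (XB T)"
  shows "c_trivial_mod T J c \<longleftrightarrow> symmetry_mod T J"
proof -
  note T = assms(1) and J = assms(3)
  interpret XB: free_alg_ideal T "xb_ideal T" by (rule free_alg_ideal.intro[OF ideal_xb_ideal])
  interpret Q: free_alg_ideal T "xb_preimage T J"
    by (rule free_alg_ideal.intro[OF ideal_xb_preimage[OF J]])
  define X' where "X' = X_at_kappa_minus_u T"
  define M where "M = contracted_X T"
  define p where "p = emb (pfun T fls_X_inv)"
  obtain d Y' where d: "\<And>k. d $ k \<in> carrier (free_alg T)" "\<And>k. c k = xb_proj T (d $ k)"
    and XB: "XB.mcong (mmul (idx T) X' Y') mone" "XB.mcong Y' Y'"
      "XB.mcong M (\<lambda>i j. p * at_u d * X' i j)"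
    unfolding X'_def M_def p_def using c_series_contraction[OF assms(1,2)] by blast
  have "Q.mcong A B" if "XB.mcong A B" for A B
    using that cong_mono[OF XB.free_alg_ideal_axioms Q.free_alg_ideal_axioms
        xb_ideal_subset_preimage[OF J]]
    by (auto simp: XB.mcong_def Q.mcong_def)
  note X'Y' = this[OF XB(1)] and Y' = this[OF XB(2)] and M = this[OF XB(3)]
  have triv: "c_trivial_mod T J c \<longleftrightarrow> Q.cong (at_u d) 1"
    by (rule c_trivial_mod_iff[OF J d])
  have symm: "symmetry_mod T J \<longleftrightarrow> Q.mcong M (\<lambda>i j. p * X' i j)"
    unfolding M_def p_def X'_def by (rule symmetry_mod_iff[OF J])
  show ?thesis
    unfolding triv symm
  proof
    assume "Q.cong (at_u d) 1"
    hence "Q.mcong (\<lambda>i j. p * at_u d * X' i j) (\<lambda>i j. p * X' i j)"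
      using Q.mcong_X_kappa[folded X'_def] Q.cong_mult[OF Q.cong_mult[OF Q.cong_emb]]
      unfolding Q.mcong_def p_def by fastforce
    thus "Q.mcong M (\<lambda>i j. p * X' i j)"
      by (rule Q.mcong_trans[OF M])
  next
    \<comment> \<open>The matrix \<open>Y'\<close> cancels \<open>X'\<close>, and then a diagonal entry suffices.\<close>
    assume "Q.mcong M (\<lambda>i j. p * X' i j)"
    hence "Q.mcong (\<lambda>i j. p * at_u d * X' i j) (\<lambda>i j. p * X' i j)"
      by (rule Q.mcong_trans[OF Q.mcong_sym[OF M]])
    hence "Q.mcong (mmul (idx T) (\<lambda>i j. p * at_u d * X' i j) Y') (mmul (idx T) (\<lambda>i j. p * X' i j) Y')"
      by (rule Q.mcong_mmul[OF _ Y'])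
    moreover have "mmul (idx T) (\<lambda>i j. x * X' i j) Y' = (\<lambda>i j. x * mmul (idx T) X' Y' i j)" for x
      by (intro ext) (simp add: mmul_def sum_distrib_left mult.assoc)
    ultimately have scaled: "Q.mcong (\<lambda>i j. p * at_u d * mmul (idx T) X' Y' i j)
        (\<lambda>i j. p * mmul (idx T) X' Y' i j)"
      by simp
    have inv: "Q.mcong (\<lambda>i j. x * mmul (idx T) X' Y' i j) (\<lambda>i j. x * mone i j)"
      if "Q.cong x x" for x
      using X'Y' that unfolding Q.mcong_def by (auto intro!: Q.cong_mult)
    have self: "Q.cong p p" "Q.cong (p * at_u d) (p * at_u d)"
      unfolding p_def by (intro Q.cong_mult Q.cong_emb Q.cong_at_u d)+
    have "Q.mcong (\<lambda>i j. p * at_u d * mone i j) (\<lambda>i j. p * mone i j)"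
      by (rule Q.mcong_trans[OF Q.mcong_sym[OF inv[OF self(2)]] Q.mcong_trans[OF scaled inv[OF self(1)]]])
    hence "Q.cong (p * at_u d) p"
      using one_in_idx[OF T] by (force simp: Q.mcong_def mone_def)
    hence "Q.cong (emb (1 / pfun T fls_X_inv) * (p * at_u d)) (emb (1 / pfun T fls_X_inv) * p)"
      by (rule Q.cong_mult[OF Q.cong_emb])
    moreover have "emb (1 / pfun T fls_X_inv) * p = 1"
      unfolding p_def emb_mult[symmetric] using pfun_nonzero[of T] by simp
    ultimately show "Q.cong (at_u d) 1"
      by (metis mult.assoc mult_1_left)
  qed
qed

end
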